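(* Let $\ell=(i_1,\dots,i_l)$ be a finite nonempty ordered collection of positive integers, let $\tilde\varphi_\ell(n)=\tilde\varphi_{i_1}(n)\cdots\tilde\varphi_{i_l}(n)$, let $\Phi_\ell=\lim_{n\to\infty}\frac1n\sum_{k=1}^n\tilde\varphi_\ell(k)$, and for each nonnegative integer $s$ define $$\xi_{\ell,s}(n)=\frac{1}{n^s}\left(\sum_{k=1}^n k^s\tilde\varphi_\ell(k)-\frac{n^{s+1}}{s+1}\Phi_\ell\right),\quad n\in\mathbb{N}.$$ If the Ces\`aro limit $\lim_{n\to\infty}\frac1n\sum_{m=1}^n\xi_{\ell,0}(m)$ exists, then for every integer $s>0$ the Ces\`aro limit $\lim_{n\to\infty}\frac1n\sum_{m=1}^n\xi_{\ell,s}(m)$ exists and equals $\frac12\Phi_\ell$.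
   Context: For a positive integer $k$, $\tilde\varphi_k:\mathbb{N}\to\mathbb{R}$ is defined by $\tilde\varphi_k(p_1^{l_1}\cdots p_m^{l_m})=\prod_{r=1}^m\left(1-\frac{1}{p_r^k}\right)$ for pairwise distinct primes $p_r$ and $l_r\ge1$ (so $\tilde\varphi_k(1)=1$). The limit $\Phi_\ell$ exists (it equals $\prod_p\left(1-\frac1p\left(1-\prod_{j=1}^l(1-p^{-i_j})\right)\right)$, product over all primes). *)

theory Defs
  imports Complex_Main "HOL-Computational_Algebra.Primes"
begin

definition phi_tilde :: "nat \<Rightarrow> nat \<Rightarrow> real" where
  "phi_tilde k n = (\<Prod>p\<in>prime_factors n. 1 - 1 / real p ^ k)"

text \<open>An ordered collection of indices is a list; repetitions are allowed and count with
  multiplicity.\<close>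

definition phi_tilde_list :: "nat list \<Rightarrow> nat \<Rightarrow> real" where
  "phi_tilde_list ls n = (\<Prod>i\<leftarrow>ls. phi_tilde i n)"

text \<open>Arithmetic functions are indexed by positive integers, so the sum starts at 1; the value
  at \<open>n = 0\<close> is the junk value 0 and is irrelevant to limits.\<close>

definition cesaro_mean :: "(nat \<Rightarrow> real) \<Rightarrow> nat \<Rightarrow> real" where
  "cesaro_mean f n = 1 / real n * (\<Sum>m=1..n. f m)"

definition Phi :: "nat list \<Rightarrow> real" where
  "Phi ls = lim (cesaro_mean (phi_tilde_list ls))"

definition xi :: "nat list \<Rightarrow> nat \<Rightarrow> nat \<Rightarrow> real" where
  "xi ls s n = 1 / real n ^ s *
     ((\<Sum>k=1..n. real k ^ s * phi_tilde_list ls k) - real n ^ (s + 1) / real (s + 1) * Phi ls)"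

end

theory Submission
  imports Defs
begin

text \<open>Write \<open>a = phi_tilde_list ls\<close>, \<open>c = Phi ls\<close> and \<open>X = xi ls 0\<close>. Since
  \<open>a k = c + X k - X (k - 1)\<close>, summation by parts gives
  \<open>xi ls s n = X n + c D n - W n\<close>, where
  \<open>D n = (1\<^sup>s + \<dots> + n\<^sup>s - n\<^bsup>s+1\<^esup>/(s+1)) / n\<^sup>s\<close> tends to \<open>1/2\<close> and
  \<open>W n = n\<^bsup>-s\<^esup> (\<Sum>k<n. ((k+1)\<^sup>s - k\<^sup>s) X k)\<close> is a weighted mean of \<open>X\<close> with increasing weights
  of polynomial growth. Such a mean tends to the Cesaro limit of \<open>X\<close> whenever the latter
  exists, so it cancels the Cesaro limit of the first term, and \<open>c/2\<close> remains.\<close>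

section \<open>Sublinear growth and Cesaro means of convergent sequences\<close>

text \<open>The additive constant absorbs finitely many initial values, so the bound holds for all
  \<open>n\<close>, even \<open>n = 0\<close>. Later estimates can thus be made uniformly, without
  carrying thresholds.\<close>

lemma sublinear_iff:
  fixes f :: "nat \<Rightarrow> real"
  shows "(\<lambda>n. f n / real n) \<longlonglongrightarrow> 0 \<longleftrightarrow> (\<forall>e>0. \<exists>C. \<forall>n. \<bar>f n\<bar> \<le> e * real n + C)"
proof (intro iffI allI impI)
  fix e :: real
  assume "(\<lambda>n. f n / real n) \<longlonglongrightarrow> 0" and e: "e > 0"
  then obtain N where N: "\<And>n. n \<ge> N \<Longrightarrow> \<bar>f n / real n\<bar> < e"
    by (auto simp: LIMSEQ_iff)
  have "\<bar>f n\<bar> \<le> e * real n + (\<Sum>k\<le>N. \<bar>f k\<bar>)" for n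
  proof (cases "n \<le> N")
    case True
    then have "\<bar>f n\<bar> \<le> (\<Sum>k\<le>N. \<bar>f k\<bar>)"
      by (intro member_le_sum) auto
    then show ?thesis
      using e by (simp add: add_increasing)
  next
    case False
    then have "\<bar>f n\<bar> \<le> e * real n"
      using N[of n] by (simp add: abs_divide field_simps)
    moreover have "0 \<le> (\<Sum>k\<le>N. \<bar>f k\<bar>)"
      by (rule sum_nonneg) simp
    ultimately show ?thesis
      by linarith
  qed
  then show "\<exists>C. \<forall>n. \<bar>f n\<bar> \<le> e * real n + C"
    by blast
next
  assume bound: "\<forall>e>0. \<exists>C. \<forall>n. \<bar>f n\<bar> \<le> e * real n + C"
  show "(\<lambda>n. f n / real n) \<longlonglongrightarrow> 0"
  proof (rule LIMSEQ_I)
    fix e :: real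
    assume e: "0 < e"
    then obtain C where C: "\<And>n. \<bar>f n\<bar> \<le> e / 2 * real n + C"
      using bound by (meson half_gt_zero)
    obtain N where N: "2 * C / e < real N"
      using reals_Archimedean2 by blast
    have "norm (f n / real n - 0) < e" if "n \<ge> Suc N" for n
    proof -
      have "2 * C / e < real n"
        using N that by linarith
      then have "C < e / 2 * real n"
        using e by (simp add: field_simps)
      then have "\<bar>f n\<bar> < e * real n"
        using C[of n] by linarith
      then show ?thesis
        using that by (simp add: abs_divide field_simps)
    qed
    then show "\<exists>no. \<forall>n\<ge>no. norm (f n / real n - 0) < e"
      by blast
  qed
qed

text \<open>All but finitely many terms are below \<open>e\<close> in absolute value; the others add
  only a constant to the partial sums.\<close>

lemma tendsto_mean_zero:
  fixes y :: "nat \<Rightarrow> real"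
  assumes "y \<longlonglongrightarrow> 0"
  shows "(\<lambda>n. (\<Sum>k=1..n. y k) / real n) \<longlonglongrightarrow> 0"
  unfolding sublinear_iff
proof (intro allI impI)
  fix e :: real
  assume e: "e > 0"
  then obtain N where N: "\<And>n. n \<ge> N \<Longrightarrow> \<bar>y n\<bar> < e"
    using assms by (auto simp: LIMSEQ_iff)
  define C where "C = (\<Sum>k\<le>N. \<bar>y k\<bar>)"
  have C: "\<bar>y k\<bar> \<le> e + (if k \<le> N then \<bar>y k\<bar> else 0)" for k
    using N[of k] e by auto
  have "\<bar>\<Sum>k=1..n. y k\<bar> \<le> e * real n + C" for n
  proof -
    have "\<bar>\<Sum>k=1..n. y k\<bar> \<le> (\<Sum>k=1..n. \<bar>y k\<bar>)"
      by (rule sum_abs)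
    also have "\<dots> \<le> (\<Sum>k=1..n. e + (if k \<le> N then \<bar>y k\<bar> else 0))"
      by (intro sum_mono C)
    also have "\<dots> = e * real n + (\<Sum>k\<in>{1..n} \<inter> {..N}. \<bar>y k\<bar>)"
      by (simp add: sum.distrib sum.If_cases atMost_def)
    also have "(\<Sum>k\<in>{1..n} \<inter> {..N}. \<bar>y k\<bar>) \<le> C"
      unfolding C_def by (intro sum_mono2) auto
    finally show ?thesis
      by simp
  qed
  then show "\<exists>C. \<forall>n. \<bar>\<Sum>k=1..n. y k\<bar> \<le> e * real n + C"
    by blast
qed

lemma cesaro_mean_tendsto:
  assumes "f \<longlonglongrightarrow> l"
  shows "cesaro_mean f \<longlonglongrightarrow> l"
proof -
  have "(\<lambda>n. (\<Sum>k=1..n. f k - l) / real n) \<longlonglongrightarrow> 0"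
    using assms by (intro tendsto_mean_zero) (simp add: LIM_zero)
  then have "(\<lambda>n. (\<Sum>k=1..n. f k - l) / real n + l) \<longlonglongrightarrow> l"
    using tendsto_add[OF _ tendsto_const[of l]] by fastforce
  moreover have "\<forall>\<^sub>F n in sequentially. (\<Sum>k=1..n. f k - l) / real n + l = cesaro_mean f n"
    using eventually_gt_at_top[of 0]
    by eventually_elim (simp add: cesaro_mean_def sum_subtractf field_simps)
  ultimately show ?thesis
    using tendsto_cong by fast
qed

section \<open>Summation by parts and means with power weights\<close>

lemma sum_by_parts:
  fixes w b :: "nat \<Rightarrow> real"
  shows "(\<Sum>k<n. w k * b k) =
    w n * (\<Sum>k<n. b k) - (\<Sum>k<n. (w (Suc k) - w k) * (\<Sum>j<Suc k. b j))"
  by (induction n) (auto simp: algebra_simps)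

text \<open>After summation by parts, the boundary term costs at most \<open>w n * M\<close>; the
  increments of \<open>w\<close> are nonnegative and telescope, so the remaining sum costs no more
  than that again.\<close>

lemma abs_sum_mult_le:
  fixes w b :: "nat \<Rightarrow> real"
  assumes w: "mono w" "w 0 \<ge> 0"
    and M: "\<And>k. k \<le> n \<Longrightarrow> \<bar>\<Sum>j<k. b j\<bar> \<le> M"
  shows "\<bar>\<Sum>k<n. w k * b k\<bar> \<le> 2 * w n * M"
proof -
  have "w n \<ge> 0"
    using monoD[OF w(1), of 0 n] w(2) by simp
  then have 1: "\<bar>w n * (\<Sum>k<n. b k)\<bar> \<le> w n * M"
    by (simp add: abs_mult M mult_left_mono)
  have "\<bar>\<Sum>k<n. (w (Suc k) - w k) * (\<Sum>j<Suc k. b j)\<bar>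
      \<le> (\<Sum>k<n. \<bar>(w (Suc k) - w k) * (\<Sum>j<Suc k. b j)\<bar>)"
    by (rule sum_abs)
  also have "\<dots> \<le> (\<Sum>k<n. (w (Suc k) - w k) * M)"
  proof (rule sum_mono)
    fix k assume "k \<in> {..<n}"
    then have "\<bar>\<Sum>j<Suc k. b j\<bar> \<le> M"
      by (intro M) simp
    moreover have "0 \<le> w (Suc k) - w k"
      using monoD[OF w(1), of k "Suc k"] by simp
    ultimately show "\<bar>(w (Suc k) - w k) * (\<Sum>j<Suc k. b j)\<bar> \<le> (w (Suc k) - w k) * M"
      by (simp only: abs_mult abs_of_nonneg mult_left_mono)
  qed
  also have "\<dots> = (w n - w 0) * M"
    by (simp add: sum_distrib_right[symmetric] sum_lessThan_telescope)
  also have "\<dots> \<le> w n * M"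
    using w(2) M[of 0] by (intro mult_right_mono) auto
  finally show ?thesis
    using 1 unfolding sum_by_parts[of w b] by linarith
qed

text \<open>By \<open>step\<close>, each difference arises from the previous one through products
  and sums of nonnegative increasing functions.\<close>

lemma mono_power_diff: "mono (\<lambda>k. real (Suc k) ^ s - real k ^ s)"
proof (induction s)
  case (Suc s)
  have step: "real (Suc k) ^ Suc s - real k ^ Suc s
      = real (Suc k) * (real (Suc k) ^ s - real k ^ s) + real k ^ s" for k
    by (simp add: algebra_simps)
  show ?case
    unfolding step
    by (intro monoI add_mono mult_mono power_mono monoD[OF Suc])
      (auto simp del: of_nat_Suc simp: power_mono)
qed (simp add: mono_def)

text \<open>The recursion behind \<open>mono_power_diff\<close> again, now with
  \<open>n + 1 \<le> 2 * n\<close>, which is where \<open>n > 0\<close> enters. The constant gives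
  equality at \<open>n = 1\<close>.\<close>

lemma power_diff_le:
  assumes "n > 0"
  shows "real (Suc n) ^ Suc r - real n ^ Suc r \<le> (2 ^ Suc r - 1) * real n ^ r"
proof (induction r)
  case (Suc r)
  define d where "d = real (Suc n) ^ Suc r - real n ^ Suc r"
  have "real (Suc n) ^ Suc (Suc r) - real n ^ Suc (Suc r) = real (Suc n) * d + real n ^ Suc r"
    by (simp add: d_def algebra_simps)
  also have "real (Suc n) * d \<le> (2 * real n) * ((2 ^ Suc r - 1) * real n ^ r)"
    using assms Suc by (intro mult_mono) (auto simp: d_def intro!: mult_mono power_mono)
  also have "\<dots> + real n ^ Suc r = (2 ^ Suc (Suc r) - 1) * real n ^ Suc r"
    by (simp add: algebra_simps)
  finally show ?case
    by simp
qed simp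

lemma sum_power_diff: "(\<Sum>k<n. real (Suc k) ^ Suc r - real k ^ Suc r) = real n ^ Suc r"
  by (subst sum_lessThan_telescope) simp

text \<open>The last weight is of order \<open>n ^ r\<close> and the partial sums of
  \<open>b\<close> are sublinear, so \<open>abs_sum_mult_le\<close> makes the numerator small
  against \<open>n ^ Suc r\<close>.\<close>

lemma weighted_mean_tendsto:
  fixes b :: "nat \<Rightarrow> real"
  assumes "(\<lambda>n. (\<Sum>k<n. b k) / real n) \<longlonglongrightarrow> 0"
  shows "(\<lambda>n. (\<Sum>k<n. (real (Suc k) ^ Suc r - real k ^ Suc r) * b k) / real n ^ Suc r) \<longlonglongrightarrow> 0"
proof -
  define w where "w k = real (Suc k) ^ Suc r - real k ^ Suc r" for k
  define K :: real where "K = 2 ^ Suc r"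
  have K: "K > 0"
    by (simp add: K_def)
  have w: "mono w" "w 0 \<ge> 0"
    unfolding w_def by (rule mono_power_diff) simp
  have wK: "w n \<le> K * real n ^ r" if "n > 0" for n
  proof -
    have "w n \<le> (K - 1) * real n ^ r"
      unfolding w_def K_def by (rule power_diff_le[OF that])
    also have "\<dots> \<le> K * real n ^ r"
      by (intro mult_right_mono) auto
    finally show ?thesis .
  qed
  have "(\<lambda>n. (\<Sum>k<n. w k * b k) / real n ^ r / real n) \<longlonglongrightarrow> 0"
    unfolding sublinear_iff
  proof (intro allI impI)
    fix e :: real
    assume e: "e > 0"
    \<comment> \<open>Chosen so that the factor 2 from \<open>abs_sum_mult_le\<close> and the factor
      \<open>K\<close> from \<open>wK\<close> turn \<open>d\<close> into \<open>e\<close>.\<close>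
    define d where "d = e / (2 * K)"
    have d: "d > 0"
      using e K by (simp add: d_def)
    then obtain C where C: "\<And>n. \<bar>\<Sum>k<n. b k\<bar> \<le> d * real n + C"
      using assms unfolding sublinear_iff by blast
    have C0: "C \<ge> 0"
      using C[of 0] by simp
    have "\<bar>(\<Sum>k<n. w k * b k) / real n ^ r\<bar> \<le> e * real n + 2 * K * C" for n
    proof (cases "n = 0")
      case False
      have M: "\<bar>\<Sum>j<k. b j\<bar> \<le> d * real n + C" if "k \<le> n" for k
      proof -
        have "d * real k \<le> d * real n"
          using d that by simp
        then show ?thesis
          using C[of k] by linarith
      qed
      have "\<bar>\<Sum>k<n. w k * b k\<bar> \<le> 2 * w n * (d * real n + C)"
        by (rule abs_sum_mult_le[OF w M])
      also have "\<dots> \<le> 2 * (K * real n ^ r) * (d * real n + C)"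
        using wK[of n] False d C0 by (intro mult_right_mono) auto
      also have "\<dots> = (e * real n + 2 * K * C) * real n ^ r"
        using K by (simp add: d_def field_simps)
      finally show ?thesis
        using False by (simp add: abs_divide field_simps)
    qed (use C0 K in simp)
    then show "\<exists>C. \<forall>n. \<bar>(\<Sum>k<n. w k * b k) / real n ^ r\<bar> \<le> e * real n + C"
      by blast
  qed
  then show ?thesis
    by (simp add: w_def mult.commute)
qed

section \<open>Power sums up to their second-order term\<close>

text \<open>Summing by parts with \<open>S\<^sub>s(n) = 1\<^sup>s + \<dots> + n\<^sup>s\<close> gives
  \<open>S\<^sub>s\<^sub>+\<^sub>1(n) = n S\<^sub>s(n) - (S\<^sub>s(0) + \<dots> + S\<^sub>s(n-1))\<close>, which allows induction on the
  exponent.\<close>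

lemma sum_power_asymp:
  "\<exists>C. \<forall>n. \<bar>(\<Sum>k=1..n. real k ^ Suc r) - real n ^ (r + 2) / real (r + 2) - real n ^ Suc r / 2\<bar>
    \<le> C * real n ^ r"
proof (induction r)
  case 0
  have eq: "(\<Sum>k=1..n. real k) - real n ^ 2 / 2 - real n / 2 = 0" for n
    by (induction n) (auto simp: field_simps power2_eq_square)
  then have "\<bar>(\<Sum>k=1..n. real k ^ Suc 0) - real n ^ (0 + 2) / real (0 + 2) - real n ^ Suc 0 / 2\<bar>
      \<le> 0 * real n ^ 0" for n
    using eq[of n] by (simp add: power2_eq_square)
  then show ?case
    by blast
next
  case (Suc r)
  define S where "S q n = (\<Sum>k=1..n. real k ^ q)" for q n
  define s where "s = Suc r"
  define e where "e n = S s n - real n ^ Suc s / real (Suc s) - real n ^ s / 2" for n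
  obtain C where C: "\<And>n. \<bar>e n\<bar> \<le> C * real n ^ r"
    using Suc by (auto simp: e_def S_def s_def)
  have C0: "C \<ge> 0"
    using C[of 1] by simp
  define E where "E n = (\<Sum>k<n. e k)" for n
  have S_Suc: "S q (Suc n) = S q n + real (Suc n) ^ q" for q n
    by (simp add: S_def)
  have parts: "S (Suc s) n = real n * S s n - (\<Sum>k<n. S s k)" for n
    by (induction n) (simp add: S_def, simp add: S_Suc algebra_simps)
  \<comment> \<open>The ranges differ at both ends; the extra term at \<open>k = 0\<close> vanishes
    because \<open>q > 0\<close>.\<close>
  have less: "(\<Sum>k<n. real k ^ q) = S q n - real n ^ q" if "q > 0" for q n
    using that by (induction n) (simp add: S_def, simp add: S_Suc)
  have sums: "(\<Sum>k<n. S s k) =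
      (S (Suc s) n - real n ^ Suc s) / real (Suc s) + (S s n - real n ^ s) / 2 + E n" for n
  proof -
    have "(\<Sum>k<n. S s k) = (\<Sum>k<n. real k ^ Suc s / real (Suc s) + real k ^ s / 2 + e k)"
      by (simp add: e_def)
    also have "\<dots> = (\<Sum>k<n. real k ^ Suc s) / real (Suc s) + (\<Sum>k<n. real k ^ s) / 2 + E n"
      unfolding E_def by (simp only: sum.distrib sum_divide_distrib)
    finally show ?thesis
      using less[of "Suc s" n] less[of s n] by (simp add: s_def)
  qed
  \<comment> \<open>Inserting \<open>sums\<close> into \<open>parts\<close> puts
    \<open>S (Suc s) n\<close> on both sides, with total coefficient \<open>1 + 1 / (s + 1)\<close>;
    this is the factor on the left. Only terms of order \<open>n ^ s\<close> remain on the
    right.\<close>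
  have main: "(S (Suc s) n - real n ^ (s + 2) / real (s + 2) - real n ^ Suc s / 2)
      * (real (s + 2) / real (s + 1))
    = (real n - 1 / 2) * e n - E n + real n ^ s / 4" for n
  proof -
    define P Q N x c where "P = S (Suc s) n" and "Q = S s n" and "N = real n ^ s"
      and "x = real n" and "c = real (Suc s)"
    have c: "c > 0"
      by (simp add: c_def)
    have "P = x * Q - ((P - x * N) / c + (Q - N) / 2 + E n)"
      using parts[of n] sums[of n] by (simp add: P_def Q_def N_def x_def c_def)
    then have 1: "P + P / c = x * Q + x * N / c - (Q - N) / 2 - E n"
      by (simp add: diff_divide_distrib)
    have 2: "(P - x * (x * N) / (c + 1) - x * N / 2) * ((c + 1) / c)
        = P + P / c - x * (x * N) / c - x * N / 2 - x * N / (2 * c)"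
      using c by (simp add: divide_simps) (simp add: algebra_simps)
    have 3: "(x - 1 / 2) * (Q - x * N / c - N / 2) - E n + N / 4
        = x * Q - x * (x * N) / c - x * N / 2 - Q / 2 + x * N / (2 * c) + N / 2 - E n"
      by (simp add: algebra_simps)
    have 4: "x * N / c = 2 * (x * N / (2 * c))"
      by simp
    have "(P - x * (x * N) / (c + 1) - x * N / 2) * ((c + 1) / c)
        = (x - 1 / 2) * (Q - x * N / c - N / 2) - E n + N / 4"
      unfolding 2 3 using 1 4 by argo
    then show ?thesis
      by (simp add: P_def Q_def N_def x_def c_def e_def add.commute)
  qed
  have "\<bar>S (Suc s) n - real n ^ (s + 2) / real (s + 2) - real n ^ Suc s / 2\<bar>
      \<le> (2 * C + 1 / 4) * real n ^ s" for n
  proof -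
    have En: "\<bar>E n\<bar> \<le> C * real n ^ s"
    proof -
      have "\<bar>E n\<bar> \<le> (\<Sum>k<n. \<bar>e k\<bar>)"
        unfolding E_def by (rule sum_abs)
      also have "\<dots> \<le> (\<Sum>k<n. C * real n ^ r)"
        using C0 by (intro sum_mono order.trans[OF C] mult_left_mono power_mono) auto
      finally show ?thesis
        by (simp add: s_def algebra_simps)
    qed
    have en: "\<bar>(real n - 1 / 2) * e n\<bar> \<le> C * real n ^ s"
    \<comment> \<open>The bound \<open>\<bar>n - 1 / 2\<bar> \<le> n\<close> fails at
      \<open>n = 0\<close>, but there \<open>e n = 0\<close> since \<open>s > 0\<close>.\<close>
    proof (cases "n = 0")
      case False
      then have "\<bar>real n - 1 / 2\<bar> * \<bar>e n\<bar> \<le> real n * (C * real n ^ r)"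
        by (intro mult_mono C) auto
      then show ?thesis
        by (simp add: s_def abs_mult mult_ac)
    qed (simp add: e_def S_def s_def)
    define x where "x = S (Suc s) n - real n ^ (s + 2) / real (s + 2) - real n ^ Suc s / 2"
    have "\<bar>x\<bar> * 1 \<le> \<bar>x\<bar> * (real (s + 2) / real (s + 1))"
      by (intro mult_left_mono) auto
    also have "\<dots> = \<bar>x * (real (s + 2) / real (s + 1))\<bar>"
      by (simp add: abs_mult)
    also have "\<dots> = \<bar>(real n - 1 / 2) * e n - E n + real n ^ s / 4\<bar>"
      using main[of n] by (simp add: x_def)
    also have "\<dots> \<le> C * real n ^ s + C * real n ^ s + real n ^ s / 4"
      using En en zero_le_power[of "real n" s] by linarith
    finally show ?thesis
      by (simp add: x_def algebra_simps)
  qed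
  then show ?case
    by (auto simp: S_def s_def intro!: exI[of _ "2 * C + 1 / 4"])
qed

text \<open>The limit of \<open>D n\<close>: dividing the error \<open>C * n ^ r\<close> by
  \<open>n ^ Suc r\<close> leaves \<open>C / n\<close>.\<close>

lemma sum_power_half:
  "(\<lambda>n. ((\<Sum>k=1..n. real k ^ Suc r) - real n ^ (r + 2) / real (r + 2)) / real n ^ Suc r)
    \<longlonglongrightarrow> 1 / 2"
proof -
  obtain C where C: "\<And>n. \<bar>(\<Sum>k=1..n. real k ^ Suc r) - real n ^ (r + 2) / real (r + 2)
      - real n ^ Suc r / 2\<bar> \<le> C * real n ^ r"
    using sum_power_asymp by blast
  have "(\<lambda>n. ((\<Sum>k=1..n. real k ^ Suc r) - real n ^ (r + 2) / real (r + 2)) / real n ^ Suc r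
      - 1 / 2) \<longlonglongrightarrow> 0"
  proof (rule tendsto_norm_zero_cancel, rule tendsto_sandwich[where f = "\<lambda>_. 0"])
    show "\<forall>\<^sub>F n in sequentially. norm (((\<Sum>k=1..n. real k ^ Suc r)
        - real n ^ (r + 2) / real (r + 2)) / real n ^ Suc r - 1 / 2) \<le> C / real n"
      using eventually_gt_at_top[of 0]
    proof eventually_elim
      case (elim n)
      define x where "x = (\<Sum>k=1..n. real k ^ Suc r) - real n ^ (r + 2) / real (r + 2)"
      have "\<bar>x / real n ^ Suc r - 1 / 2\<bar> = \<bar>(x - real n ^ Suc r / 2) / real n ^ Suc r\<bar>"
        using elim by (simp add: diff_divide_distrib)
      also have "\<dots> \<le> C * real n ^ r / real n ^ Suc r"
        using divide_right_mono[OF C[of n], of "real n ^ Suc r"]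
        by (simp add: abs_divide x_def del: power_Suc)
      finally show ?case
        using elim by (simp add: x_def)
    qed
    show "(\<lambda>n. C / real n) \<longlonglongrightarrow> 0"
      by (rule lim_const_over_n)
  qed simp_all
  then show ?thesis
    by (rule LIM_zero_cancel)
qed

section \<open>Decomposition of \<open>xi ls s\<close> and passage to Cesaro limits\<close>

text \<open>Summation by parts in inductive form: the assumption gives
  \<open>a (Suc n) = X (Suc n) - X n + c\<close>, and also \<open>X 0 = 0\<close> for the base
  case.\<close>

lemma sum_power_mult:
  fixes a X :: "nat \<Rightarrow> real"
  assumes "\<And>n. X n = (\<Sum>k=1..n. a k) - real n * c"
  shows "(\<Sum>k=1..n. real k ^ s * a k) =
    c * (\<Sum>k=1..n. real k ^ s) + real n ^ s * X n
    - (\<Sum>k<n. (real (Suc k) ^ s - real k ^ s) * X k)"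
proof (induction n)
  case (Suc n)
  have a: "a (Suc n) = X (Suc n) - X n + c"
    by (simp add: assms algebra_simps)
  show ?case
    using Suc by (simp add: a algebra_simps)
qed (simp add: assms)

theorem theorem3:
  fixes ls :: "nat list"
  assumes "ls \<noteq> []"
    and "\<forall>i\<in>set ls. i > 0"
    and "convergent (cesaro_mean (xi ls 0))"
  shows "\<forall>s>0. cesaro_mean (xi ls s) \<longlonglongrightarrow> 1 / 2 * Phi ls"
proof (intro allI impI)
  fix s :: nat
  assume "s > 0"
  then obtain r where s: "s = Suc r"
    by (cases s) auto
  define c where "c = Phi ls"
  define X where "X = xi ls 0"
  obtain L where L: "cesaro_mean X \<longlonglongrightarrow> L"
    using assms(3) unfolding X_def convergent_def by blast
  \<comment> \<open>This includes \<open>n = 0\<close>, since \<open>0 ^ 0 = 1\<close>; hence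
    \<open>X 0 = 0\<close>.\<close>
  have X: "X n = (\<Sum>k=1..n. phi_tilde_list ls k) - real n * c" for n
    by (simp add: X_def xi_def c_def)
  define w where "w k = real (Suc k) ^ s - real k ^ s" for k
  \<comment> \<open>Cesaro means run over \<open>1..n\<close>, the weighted mean over
    \<open>k < n\<close>. As \<open>X 0 = 0\<close>, passing from one to the other only shifts the
    index and costs a factor \<open>n / (n + 1)\<close>, which tends to 1.\<close>
  have "(\<lambda>n. (\<Sum>k<n. X k - L) / real n) \<longlonglongrightarrow> 0"
  proof (rule LIMSEQ_imp_Suc)
    have "(\<lambda>n. cesaro_mean X n * (real n / real (Suc n)) - L) \<longlonglongrightarrow> L * 1 - L"
      by (intro tendsto_intros L LIMSEQ_n_over_Suc_n)
    moreover have "cesaro_mean X n * (real n / real (Suc n)) - L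
        = (\<Sum>k<Suc n. X k - L) / real (Suc n)" for n
    proof -
      have "{..<Suc n} = insert 0 {1..n}"
        by auto
      then have "(\<Sum>k<Suc n. X k) = (\<Sum>k=1..n. X k)"
        by (simp add: X)
      moreover have "cesaro_mean X n * real n = (\<Sum>k=1..n. X k)"
        by (simp add: cesaro_mean_def)
      ultimately show ?thesis
        by (simp only: sum_subtractf times_divide_eq_right) (simp add: field_simps)
    qed
    ultimately show "(\<lambda>n. (\<Sum>k<Suc n. X k - L) / real (Suc n)) \<longlonglongrightarrow> 0"
      by simp
  qed
  then have W: "(\<lambda>n. (\<Sum>k<n. w k * (X k - L)) / real n ^ s) \<longlonglongrightarrow> 0"
    unfolding w_def s by (rule weighted_mean_tendsto)
  \<comment> \<open>The weights sum to \<open>n ^ s\<close>, so centring \<open>X\<close> at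
    \<open>L\<close> shifts the weighted mean by exactly \<open>L\<close>.\<close>
  have w_sum: "(\<Sum>k<n. w k * (X k - L)) = (\<Sum>k<n. w k * X k) - L * real n ^ s" for n
  proof -
    have "(\<Sum>k<n. w k) = real n ^ s"
      unfolding w_def s by (rule sum_power_diff)
    then show ?thesis
      by (simp only: right_diff_distrib sum_subtractf sum_distrib_right[symmetric] mult.commute[of L])
  qed
  define T where "T n = (\<Sum>k=1..n. real k ^ s) - real n ^ (s + 1) / real (s + 1)" for n
  have T: "(\<lambda>n. T n / real n ^ s) \<longlonglongrightarrow> 1 / 2"
    using sum_power_half[of r] by (simp add: T_def s)
  have diff: "xi ls s n - X n
      = c * (T n / real n ^ s) - (\<Sum>k<n. w k * (X k - L)) / real n ^ s - L" if "n > 0" for n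
  proof -
    have "xi ls s n = 1 / real n ^ s * (c * T n + real n ^ s * X n - (\<Sum>k<n. w k * X k))"
      unfolding xi_def sum_power_mult[of X, OF X] c_def[symmetric]
      by (simp add: T_def w_def algebra_simps)
    then show ?thesis
      using that unfolding w_sum by (simp add: field_simps)
  qed
  have ev: "\<forall>\<^sub>F n in sequentially. c * (T n / real n ^ s)
      - (\<Sum>k<n. w k * (X k - L)) / real n ^ s - L = xi ls s n - X n"
    using eventually_gt_at_top[of 0] by eventually_elim (rule diff[symmetric])
  have "(\<lambda>n. c * (T n / real n ^ s) - (\<Sum>k<n. w k * (X k - L)) / real n ^ s - L)
      \<longlonglongrightarrow> c * (1 / 2) - 0 - L"
    by (intro tendsto_intros T W)
  then have "(\<lambda>n. xi ls s n - X n) \<longlonglongrightarrow> c / 2 - L"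
    unfolding tendsto_cong[OF ev] by simp
  \<comment> \<open>The difference \<open>xi ls s n - X n\<close> converges in the ordinary sense,
    hence also in the Cesaro sense; adding the Cesaro limit \<open>L\<close> of \<open>X\<close>
    cancels \<open>- L\<close>.\<close>
  from tendsto_add[OF cesaro_mean_tendsto[OF this] L]
  show "cesaro_mean (xi ls s) \<longlonglongrightarrow> 1 / 2 * Phi ls"
    by (simp add: cesaro_mean_def[abs_def] sum_subtractf diff_divide_distrib c_def)
qed

end
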